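(* Let $M$ be a smooth manifold of dimension $n$, let $G^i(x,y)$ be the local coefficients of a spray on $TM$, and let $F^i(x,y)$ be the components of a d-vector field. Let $c:[0,1]\to M$, $t\mapsto (x^i(t))$, be a solution curve, with $y^i=\dot x^i$, of the system $$\frac{\delta y^i}{dt}=F^i(x,y).$$ Let $(t,u)\mapsto (x^i(t,u))$ be a smooth variation of $c$ (not necessarily with fixed endpoints), with $x^i(t,0)=x^i(t)$, such that for each fixed $u$ the curve $t\mapsto x^i(t,u)$ is a solution of this system. Then the components $w^i(t)=\frac{\partial x^i}{\partial u}\big|_{u=0}$ of the deviation vector field satisfy along $c$ the Jacobi-type equation $$\frac{D^2w^i}{dt^2}=\frac{DF^i}{\partial u}\Big|_{u=0}+y^hy^jR_{h\ kj}^{\ i}\,w^k .$$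
   Context: Summation over repeated indices is used. $(x^i,y^i)$ are the natural local coordinates on $TM$. Spray coefficients $G^i(x,y)$ are 2-homogeneous in $y$, $2G^i=\frac{\partial G^i}{\partial y^j}y^j$, and smooth for $y\neq 0$; under changes of coordinates on $M$ they transform so that $\ddot x^i+2G^i(x,\dot x)=0$ is a globally defined system. All objects are considered at $y\ne 0$ and all curves are regular ($\dot x\neq 0$). A d-vector field $F^i(x,y)$ is a collection of smooth functions in the charts that transform as $\tilde F^i=\frac{\partial\tilde x^i}{\partial x^j}F^j$. Put $N^i_{\ j}=\frac{\partial G^i}{\partial y^j}$, $L^i_{\ jk}=\frac{\partial N^i_{\ j}}{\partial y^k}=\frac{\partial^2G^i}{\partial y^j\partial y^k}$ (Berwald connection coefficients), and $\delta_k=\frac{\partial}{\partial x^k}-N^j_{\ k}\frac{\partial}{\partial y^j}$. The curvature components of the Berwald connection are $$R_{j\ kl}^{\ i}=\delta_lL^i_{\ jk}-\delta_kL^i_{\ jl}+L^m_{\ jk}L^i_{\ ml}-L^m_{\ jl}L^i_{\ mk}.$$ Along a curve with $y=\dot x$: $\frac{\delta y^i}{dt}=\frac{dy^i}{dt}+N^i_{\ j}(x,y)y^j$. For a vector field $w^i(t)$ along the curve, $\frac{Dw^i}{dt}=\frac{dw^i}{dt}+N^i_{\ j}(x,y)w^j$ (equivalently $\frac{dw^i}{dt}+L^i_{\ jk}(x,y)w^jy^k$), and $\frac{D^2w^i}{dt^2}=\frac{D}{dt}\left(\frac{Dw}{dt}\right)^i$. For the variation, with $y^i(t,u)=\frac{\partial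 x^i}{\partial t}$, the Berwald covariant derivative of $F$ in the direction $u$ is $$\frac{DF^i}{\partial u}=\frac{\partial}{\partial u}\big[F^i(x(t,u),y(t,u))\big]+L^i_{\ jk}(x,y)F^j\frac{\partial x^k}{\partial u}.$$ *)

theory Defs
  imports "HOL-Analysis.Analysis"
begin

text \<open>Only meaningful for open \<open>S\<close>, since the derivatives are not taken within \<open>S\<close>.\<close>

primrec Ck_on :: "nat \<Rightarrow> 'a::real_normed_vector set \<Rightarrow> ('a \<Rightarrow> 'b::real_normed_vector) \<Rightarrow> bool" where
  "Ck_on 0 S f \<longleftrightarrow> continuous_on S f"
| "Ck_on (Suc k) S f \<longleftrightarrow>
     (\<forall>x\<in>S. f differentiable (at x)) \<and> (\<forall>v. Ck_on k S (\<lambda>x. frechet_derivative f (at x) v))"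

definition smooth_on :: "'a::real_normed_vector set \<Rightarrow> ('a \<Rightarrow> 'b::real_normed_vector) \<Rightarrow> bool" where
  "smooth_on S f \<longleftrightarrow> (\<forall>k. Ck_on k S f)"

type_synonym ('a, 'n) chart = "'a set \<times> ('a \<Rightarrow> real ^ 'n)"

definition trans_map :: "('a, 'n) chart \<Rightarrow> ('a, 'n) chart \<Rightarrow> real ^ 'n \<Rightarrow> real ^ 'n" where
  "trans_map C D = snd D \<circ> inv_into (fst C) (snd C)"

text \<open>The atlas is not required to be maximal.\<close>

definition smooth_manifold :: "'a topology \<Rightarrow> ('a, 'n::finite) chart set \<Rightarrow> bool" where
  "smooth_manifold X A \<longleftrightarrow>
     Hausdorff_space X \<and> second_countable X \<and> (\<Union>C\<in>A. fst C) = topspace X \<and>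
     (\<forall>C\<in>A. openin X (fst C) \<and> open (snd C ` fst C) \<and>
        homeomorphic_map (subtopology X (fst C)) (top_of_set (snd C ` fst C)) (snd C)) \<and>
     (\<forall>C\<in>A. \<forall>D\<in>A. smooth_on (snd C ` (fst C \<inter> fst D)) (trans_map C D))"

text \<open>
  Smoothness of a map from an arbitrary subset \<open>S\<close> of a normed space (such as \<open>[0,1]\<close> or
  \<open>[0,1] \<times> (-\<epsilon>,\<epsilon>)\<close>) into the manifold: in every chart it extends, near each point of \<open>S\<close>,
  to a smooth map on an open set. The condition includes continuity.
\<close>

definition smooth_map_into ::
    "('a, 'n::finite) chart set \<Rightarrow> 'b::real_normed_vector set \<Rightarrow> ('b \<Rightarrow> 'a) \<Rightarrow> bool" where
  "smooth_map_into A S f \<longleftrightarrow>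
     f ` S \<subseteq> (\<Union>C\<in>A. fst C) \<and>
     (\<forall>C\<in>A. \<forall>p\<in>S. f p \<in> fst C \<longrightarrow>
        (\<exists>W g. open W \<and> p \<in> W \<and> smooth_on W g \<and>
           (\<forall>q\<in>S \<inter> W. f q \<in> fst C \<and> snd C (f q) = g q)))"

text \<open>Points of \<open>TM\<close> in local coordinates are pairs \<open>(x, y)\<close>; only \<open>y \<noteq> 0\<close> matters.\<close>

type_synonym 'n field = "(real ^ 'n) \<times> (real ^ 'n) \<Rightarrow> real ^ 'n"

definition slit_domain :: "('a, 'n::finite) chart \<Rightarrow> ((real ^ 'n) \<times> (real ^ 'n)) set" where
  "slit_domain C = (snd C ` fst C) \<times> (UNIV - {0})"

definition pd :: "'n::finite \<Rightarrow> (real ^ 'n \<Rightarrow> real) \<Rightarrow> real ^ 'n \<Rightarrow> real" where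
  "pd k f x = frechet_derivative f (at x) (axis k 1)"

definition push :: "(real ^ 'n \<Rightarrow> real ^ 'n) \<Rightarrow> real ^ 'n \<Rightarrow> real ^ 'n \<Rightarrow> real ^ 'n::finite" where
  "push \<tau> x v = (\<chi> i. \<Sum>j\<in>UNIV. pd j (\<lambda>z. \<tau> z $ i) x * v $ j)"

text \<open>
  The transformation law says that \<open>x'' + 2 G(x, x') = 0\<close> is a global system: under
  \<open>x \<mapsto> \<tau> x\<close> the acceleration becomes \<open>\<tau>'(x'') + \<tau>''(x', x')\<close>. Homogeneity is positive
  homogeneity, which on \<open>y \<noteq> 0\<close> amounts to Euler's relation
  \<open>2 G\<^sup>i = (\<partial>G\<^sup>i/\<partial>y\<^sup>j) y\<^sup>j\<close>.
\<close>

definition spray :: "('a, 'n::finite) chart set \<Rightarrow> (('a, 'n) chart \<Rightarrow> 'n field) \<Rightarrow> bool" where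
  "spray A G \<longleftrightarrow>
     (\<forall>C\<in>A. smooth_on (slit_domain C) (G C) \<and>
        (\<forall>(x, y)\<in>slit_domain C. \<forall>r>0. G C (x, r *\<^sub>R y) = r\<^sup>2 *\<^sub>R G C (x, y))) \<and>
     (\<forall>C\<in>A. \<forall>D\<in>A. \<forall>x \<in> snd C ` (fst C \<inter> fst D). \<forall>y. y \<noteq> 0 \<longrightarrow>
        (let \<tau> = trans_map C D in
          \<forall>i. 2 * G D (\<tau> x, push \<tau> x y) $ i =
             2 * (\<Sum>j\<in>UNIV. pd j (\<lambda>z. \<tau> z $ i) x * G C (x, y) $ j)
             - (\<Sum>j\<in>UNIV. \<Sum>k\<in>UNIV. pd j (pd k (\<lambda>z. \<tau> z $ i)) x * y $ j * y $ k)))"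

definition d_vector_field ::
    "('a, 'n::finite) chart set \<Rightarrow> (('a, 'n) chart \<Rightarrow> 'n field) \<Rightarrow> bool" where
  "d_vector_field A F \<longleftrightarrow>
     (\<forall>C\<in>A. smooth_on (slit_domain C) (F C)) \<and>
     (\<forall>C\<in>A. \<forall>D\<in>A. \<forall>x \<in> snd C ` (fst C \<inter> fst D). \<forall>y. y \<noteq> 0 \<longrightarrow>
        (let \<tau> = trans_map C D in F D (\<tau> x, push \<tau> x y) = push \<tau> x (F C (x, y))))"

definition pdx :: "'n::finite \<Rightarrow> ((real ^ 'n) \<times> (real ^ 'n) \<Rightarrow> real) \<Rightarrow> (real ^ 'n) \<times> (real ^ 'n) \<Rightarrow> real" where
  "pdx k f p = frechet_derivative f (at p) (axis k 1, 0)"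

definition pdy :: "'n::finite \<Rightarrow> ((real ^ 'n) \<times> (real ^ 'n) \<Rightarrow> real) \<Rightarrow> (real ^ 'n) \<times> (real ^ 'n) \<Rightarrow> real" where
  "pdy k f p = frechet_derivative f (at p) (0, axis k 1)"

text \<open>\<open>Nconn G i j\<close> is \<open>N\<^sup>i\<^sub>j\<close> and \<open>Lconn G i j k\<close> is \<open>L\<^sup>i\<^sub>j\<^sub>k\<close>.\<close>

definition Nconn :: "'n field \<Rightarrow> 'n \<Rightarrow> 'n::finite \<Rightarrow> (real ^ 'n) \<times> (real ^ 'n) \<Rightarrow> real" where
  "Nconn G i j = pdy j (\<lambda>p. G p $ i)"

definition Lconn :: "'n field \<Rightarrow> 'n \<Rightarrow> 'n \<Rightarrow> 'n::finite \<Rightarrow> (real ^ 'n) \<times> (real ^ 'n) \<Rightarrow> real" where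
  "Lconn G i j k = pdy k (Nconn G i j)"

definition delta ::
    "'n field \<Rightarrow> 'n::finite \<Rightarrow> ((real ^ 'n) \<times> (real ^ 'n) \<Rightarrow> real) \<Rightarrow> (real ^ 'n) \<times> (real ^ 'n) \<Rightarrow> real" where
  "delta G k f p = pdx k f p - (\<Sum>j\<in>UNIV. Nconn G j k p * pdy j f p)"

text \<open>
  \<open>Rcurv G j i k l\<close> has upper index \<open>i\<close> and lower indices \<open>j\<close>, \<open>k\<close>, \<open>l\<close>; the arguments are
  in the order in which the indices of the curvature components are written.
\<close>

definition Rcurv ::
    "'n field \<Rightarrow> 'n \<Rightarrow> 'n \<Rightarrow> 'n \<Rightarrow> 'n::finite \<Rightarrow> (real ^ 'n) \<times> (real ^ 'n) \<Rightarrow> real" where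
  "Rcurv G j i k l p =
     delta G l (Lconn G i j k) p - delta G k (Lconn G i j l) p
     + (\<Sum>m\<in>UNIV. Lconn G m j k p * Lconn G i m l p)
     - (\<Sum>m\<in>UNIV. Lconn G m j l p * Lconn G i m k p)"

text \<open>Derivatives in \<open>t\<close> are one-sided at the endpoints of \<open>[0,1]\<close>.\<close>

definition ddt :: "(real \<Rightarrow> 'b::real_normed_vector) \<Rightarrow> real \<Rightarrow> 'b" where
  "ddt f t = vector_derivative f (at t within {0..1})"

text \<open>
  The derivative \<open>D/dt\<close> along the coordinate curve \<open>x\<close>; applied to \<open>w = y = x'\<close> it is
  \<open>\<delta>y/dt\<close>.
\<close>

definition Dt ::
    "'n field \<Rightarrow> (real \<Rightarrow> real ^ 'n) \<Rightarrow> (real \<Rightarrow> real ^ 'n) \<Rightarrow> real \<Rightarrow> real ^ 'n::finite" where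
  "Dt G x w t = (\<chi> i. ddt w t $ i + (\<Sum>j\<in>UNIV. Nconn G i j (x t, ddt x t) * w t $ j))"

definition solution_curve ::
    "('a, 'n::finite) chart set \<Rightarrow> (('a, 'n) chart \<Rightarrow> 'n field) \<Rightarrow> (('a, 'n) chart \<Rightarrow> 'n field)
      \<Rightarrow> (real \<Rightarrow> 'a) \<Rightarrow> bool" where
  "solution_curve A G F c \<longleftrightarrow>
     smooth_map_into A {0..1} c \<and>
     (\<forall>C\<in>A. \<forall>t\<in>{0..1}. c t \<in> fst C \<longrightarrow>
        (let x = snd C \<circ> c; y = ddt x in y t \<noteq> 0 \<and> Dt (G C) x y t = F C (x t, y t)))"

text \<open>
  The Berwald covariant derivative of \<open>F\<close> in the direction \<open>u\<close>, for a variation \<open>x t u\<close> in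
  local coordinates with \<open>y = \<partial>x/\<partial>t\<close>.
\<close>

definition DF_Du ::
    "'n field \<Rightarrow> 'n field \<Rightarrow> (real \<Rightarrow> real \<Rightarrow> real ^ 'n) \<Rightarrow> real \<Rightarrow> real \<Rightarrow> real ^ 'n::finite" where
  "DF_Du G F x t u =
     (let p = (\<lambda>v. (x t v, ddt (\<lambda>s. x s v) t)) in
      \<chi> i. vector_derivative (\<lambda>v. F (p v)) (at u) $ i
        + (\<Sum>j\<in>UNIV. \<Sum>k\<in>UNIV. Lconn G i j k (p u) * F (p u) $ j
              * vector_derivative (x t) (at u) $ k))"

end

theory Submission
  imports Defs
begin

text \<open>
  By Euler's relation the system reads \<open>x'' + 2 G(x, x') = F(x, x')\<close> in a chart. Differentiating
  it in \<open>u\<close> and commuting partial derivatives of the variation expresses \<open>w''\<close> through \<open>w\<close>, \<open>w'\<close>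
  and the derivative of \<open>F\<close>. Expanding \<open>D\<^sup>2w/dt\<^sup>2\<close>, the terms in \<open>w'\<close> cancel, and what remains
  besides the derivative of \<open>F\<close> is the term \<open>L F w\<close> completing it to \<open>DF/\<partial>u\<close> and
  \<open>y\<^sup>j \<partial>\<^sub>j N\<^sup>i\<^sub>k - 2 \<partial>\<^sub>k G\<^sup>i + N\<^sup>i\<^sub>m N\<^sup>m\<^sub>k - 2 L\<^sup>i\<^sub>m\<^sub>k G\<^sup>m\<close> contracted with \<open>w\<^sup>k\<close>. By homogeneity this is
  the curvature contracted twice with \<open>y\<close>.
\<close>

section \<open>Calculus of \<open>Ck_on\<close> and \<open>smooth_on\<close>\<close>

lemma frechet_derivative_vec_nth:
  fixes f :: "'a::real_normed_vector \<Rightarrow> real ^ 'n::finite"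
  assumes "f differentiable (at x)"
  shows "frechet_derivative (\<lambda>x. f x $ i) (at x) v = frechet_derivative f (at x) v $ i"
proof -
  have "((\<lambda>x. f x $ i) has_derivative (\<lambda>v. frechet_derivative f (at x) v $ i)) (at x)"
    using assms by (intro bounded_linear.has_derivative[OF bounded_linear_vec_nth])
      (simp add: frechet_derivative_works)
  then show ?thesis by (metis frechet_derivative_at)
qed

lemma differentiable_vec_nth:
  fixes f :: "'a::real_normed_vector \<Rightarrow> real ^ 'n::finite"
  assumes "f differentiable net"
  shows "(\<lambda>x. f x $ i) differentiable net"
  using assms bounded_linear.has_derivative[OF bounded_linear_vec_nth] unfolding differentiable_def by blast

lemma differentiable_transform_open:
  assumes "f differentiable (at x)" "open S" "x \<in> S" "\<And>y. y \<in> S \<Longrightarrow> f y = g y"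
  shows "g differentiable (at x)"
  using assms has_derivative_transform_within_open unfolding differentiable_def by metis

text \<open>Openness of \<open>S\<close> lets the values on \<open>S\<close> determine the
  derivatives there, so the induction can pass from \<open>f\<close> and \<open>g\<close> to their
  directional derivatives.\<close>

lemma Ck_on_cong:
  assumes "open S" "\<And>x. x \<in> S \<Longrightarrow> f x = g x" "Ck_on k S f"
  shows "Ck_on k S g"
  using assms(2,3)
proof (induction k arbitrary: f g)
  case 0
  then show ?case using continuous_on_cong by (metis Ck_on.simps(1))
next
  case (Suc k)
  have d: "\<forall>x\<in>S. f differentiable (at x)" using Suc.prems by simp
  have "Ck_on k S (\<lambda>x. frechet_derivative g (at x) v)" for v
  proof (rule Suc.IH)
    show "Ck_on k S (\<lambda>x. frechet_derivative f (at x) v)" using Suc.prems by simp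
    show "frechet_derivative f (at x) v = frechet_derivative g (at x) v" if "x \<in> S" for x
      using frechet_derivative_transform_within_open[of f x S g] d that assms(1) Suc.prems(1) by simp
  qed
  then show ?case
    using d differentiable_transform_open[OF _ assms(1) _ Suc.prems(1)] by auto
qed

lemma Ck_on_vec_nth:
  fixes f :: "'a::real_normed_vector \<Rightarrow> real ^ 'n::finite"
  assumes "open S" "Ck_on k S f"
  shows "Ck_on k S (\<lambda>x. f x $ i)"
  using assms(2)
proof (induction k arbitrary: f)
  case 0
  then show ?case by (auto intro: continuous_intros)
next
  case (Suc k)
  have "Ck_on k S (\<lambda>x. frechet_derivative (\<lambda>x. f x $ i) (at x) v)" for v
  proof (rule Ck_on_cong[OF assms(1)])
    show "Ck_on k S (\<lambda>x. frechet_derivative f (at x) v $ i)" using Suc by simp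
  qed (use Suc.prems in \<open>auto simp: frechet_derivative_vec_nth\<close>)
  then show ?case using Suc.prems by (auto intro: differentiable_vec_nth)
qed

lemma smooth_on_vec_nth:
  fixes f :: "'a::real_normed_vector \<Rightarrow> real ^ 'n::finite"
  shows "open S \<Longrightarrow> smooth_on S f \<Longrightarrow> smooth_on S (\<lambda>x. f x $ i)"
  by (simp add: smooth_on_def Ck_on_vec_nth)

lemma smooth_on_differentiable: "smooth_on S f \<Longrightarrow> x \<in> S \<Longrightarrow> f differentiable (at x)"
  unfolding smooth_on_def by (meson Ck_on.simps(2))

lemma smooth_on_frechet_derivative:
  "smooth_on S f \<Longrightarrow> smooth_on S (\<lambda>x. frechet_derivative f (at x) v)"
  unfolding smooth_on_def using Ck_on.simps(2) by blast

lemma smooth_on_subset: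
  assumes "smooth_on S f" "T \<subseteq> S"
  shows "smooth_on T f"
proof -
  have "Ck_on k S f \<Longrightarrow> Ck_on k T f" for k and f :: "'a \<Rightarrow> 'b"
    using assms(2) by (induction k arbitrary: f) (auto intro: continuous_on_subset)
  then show ?thesis using assms(1) by (simp add: smooth_on_def)
qed

lemma smooth_on_continuous_on: "smooth_on S f \<Longrightarrow> continuous_on S f"
  unfolding smooth_on_def by (meson Ck_on.simps(1))

section \<open>Chain rule along curves and symmetry of second derivatives\<close>

text \<open>Only the curve is differentiated within \<open>T\<close>. One rule thus serves the
  t-derivatives, one-sided at the ends of [0,1], and the two-sided u-derivatives.\<close>

lemma has_vector_derivative_along_curve:
  assumes "f differentiable (at (\<gamma> t))" "(\<gamma> has_vector_derivative v) (at t within T)"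
  shows "((\<lambda>s. f (\<gamma> s)) has_vector_derivative frechet_derivative f (at (\<gamma> t)) v) (at t within T)"
proof -
  have "(f has_derivative frechet_derivative f (at (\<gamma> t))) (at (\<gamma> t) within \<gamma> ` T)"
    using assms(1) frechet_derivative_works has_derivative_at_withinI by blast
  from diff_chain_within[OF assms(2)[unfolded has_vector_derivative_def] this]
  have "(f \<circ> \<gamma> has_derivative frechet_derivative f (at (\<gamma> t)) \<circ> (\<lambda>x. x *\<^sub>R v)) (at t within T)" .
  moreover have "frechet_derivative f (at (\<gamma> t)) \<circ> (\<lambda>x. x *\<^sub>R v)
      = (\<lambda>x. x *\<^sub>R frechet_derivative f (at (\<gamma> t)) v)"
    using linear_frechet_derivative[OF assms(1)] by (auto simp: linear_cmul)
  ultimately show ?thesis by (simp add: has_vector_derivative_def o_def)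
qed

lemma has_real_derivative_along_line:
  fixes f :: "'a::real_normed_vector \<Rightarrow> real"
  assumes "f differentiable (at (a + t *\<^sub>R v))"
  shows "((\<lambda>s. f (a + s *\<^sub>R v)) has_real_derivative frechet_derivative f (at (a + t *\<^sub>R v)) v) (at t)"
  unfolding has_real_derivative_iff_has_vector_derivative
  by (rule has_vector_derivative_along_curve[where f = f and \<gamma> = "\<lambda>s. a + s *\<^sub>R v", OF assms]) (auto intro!: derivative_eq_intros)

text \<open>
  Two applications of the mean value theorem. The second difference is symmetric in \<open>v\<close> and \<open>w\<close>,
  which yields the symmetry of second derivatives.
\<close>

lemma second_difference_eq:
  fixes f :: "'a::real_normed_vector \<Rightarrow> real"
  assumes "\<delta> > 0"
    and S: "\<And>s t. 0 \<le> s \<Longrightarrow> s \<le> \<delta> \<Longrightarrow> 0 \<le> t \<Longrightarrow> t \<le> \<delta> \<Longrightarrow> x + s *\<^sub>R v + t *\<^sub>R w \<in> S"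
    and f: "\<And>y. y \<in> S \<Longrightarrow> f differentiable (at y)"
    and f': "\<And>y. y \<in> S \<Longrightarrow> (\<lambda>y. frechet_derivative f (at y) v) differentiable (at y)"
  obtains s t where "0 < s" "s < \<delta>" "0 < t" "t < \<delta>"
    "f (x + \<delta> *\<^sub>R v + \<delta> *\<^sub>R w) - f (x + \<delta> *\<^sub>R v) - f (x + \<delta> *\<^sub>R w) + f x =
      \<delta> * (\<delta> * frechet_derivative (\<lambda>y. frechet_derivative f (at y) v) (at (x + s *\<^sub>R v + t *\<^sub>R w)) w)"
proof -
  let ?f' = "\<lambda>y. frechet_derivative f (at y) v"
  \<comment> \<open>Taking the difference in direction \<open>w\<close> first makes the increment of
    \<phi> over [0, \<delta>] the second difference.\<close>
  define \<phi> where "\<phi> s = f ((x + \<delta> *\<^sub>R w) + s *\<^sub>R v) - f (x + s *\<^sub>R v)" for s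
  have "(\<phi> has_real_derivative ?f' ((x + \<delta> *\<^sub>R w) + s *\<^sub>R v) - ?f' (x + s *\<^sub>R v)) (at s)"
    if "0 \<le> s" "s \<le> \<delta>" for s
    unfolding \<phi>_def
    using S[of s 0] S[of s \<delta>] that assms(1)
    by (intro DERIV_diff has_real_derivative_along_line f) (auto simp: algebra_simps)
  from MVT2[OF assms(1) this]
  obtain s where s: "0 < s" "s < \<delta>"
    "\<phi> \<delta> - \<phi> 0 = \<delta> * (?f' ((x + \<delta> *\<^sub>R w) + s *\<^sub>R v) - ?f' (x + s *\<^sub>R v))" by auto
  have "((\<lambda>t. ?f' ((x + s *\<^sub>R v) + t *\<^sub>R w)) has_real_derivative
      frechet_derivative ?f' (at ((x + s *\<^sub>R v) + t *\<^sub>R w)) w) (at t)" if "0 \<le> t" "t \<le> \<delta>" for t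
    using S[of s t] that s by (intro has_real_derivative_along_line f') auto
  from MVT2[OF assms(1) this]
  obtain t where t: "0 < t" "t < \<delta>"
    "?f' ((x + s *\<^sub>R v) + \<delta> *\<^sub>R w) - ?f' ((x + s *\<^sub>R v) + 0 *\<^sub>R w) =
      (\<delta> - 0) * frechet_derivative ?f' (at ((x + s *\<^sub>R v) + t *\<^sub>R w)) w" by blast
  have c: "x + \<delta> *\<^sub>R w + s *\<^sub>R v = x + s *\<^sub>R v + \<delta> *\<^sub>R w"
    "x + \<delta> *\<^sub>R w + \<delta> *\<^sub>R v = x + \<delta> *\<^sub>R v + \<delta> *\<^sub>R w" by (simp_all add: algebra_simps)
  show thesis
    using s(3) t(3) by (intro that[OF s(1,2) t(1,2)]) (simp add: \<phi>_def c)
qed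

text \<open>If the mixed derivatives differed at \<open>x\<close>, continuity would confine them to
  disjoint balls on a small parallelogram. The second difference over it, computed in both orders,
  forces a value of one to equal a value of the other, possibly at different points.\<close>

lemma frechet_derivative_commute:
  fixes f :: "'a::real_normed_vector \<Rightarrow> real"
  assumes "open S" "x \<in> S" and sm: "smooth_on S f"
  shows "frechet_derivative (\<lambda>y. frechet_derivative f (at y) v) (at x) w =
    frechet_derivative (\<lambda>y. frechet_derivative f (at y) w) (at x) v" (is "?A x = ?B x")
proof (rule ccontr)
  assume ne: "?A x \<noteq> ?B x"
  \<comment> \<open>Half the supposed gap as radius makes the two balls disjoint.\<close>
  let ?U = "ball (?A x) (\<bar>?A x - ?B x\<bar> / 2)" and ?V = "ball (?B x) (\<bar>?A x - ?B x\<bar> / 2)"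
  have cont: "continuous_on S ?A" "continuous_on S ?B"
    using sm by (intro smooth_on_continuous_on smooth_on_frechet_derivative; assumption)+
  define q where "q p = x + fst p *\<^sub>R v + snd p *\<^sub>R w" for p :: "real \<times> real"
  define O' where "O' = S \<inter> ?A -` ?U \<inter> (S \<inter> ?B -` ?V)"
  have "open O'"
    unfolding O'_def using cont assms(1) by (intro open_Int continuous_open_preimage) auto
  then have "open (q -` O')"
    unfolding q_def by (intro open_vimage continuous_intros) auto
  moreover have "0 \<in> q -` O'" using ne assms(2) by (auto simp: q_def O'_def)
  ultimately obtain r where r: "r > 0" "ball 0 r \<subseteq> q -` O'"
    by (meson openE)
  \<comment> \<open>Then s + t \<le> 2r/3 < r for all parameters of the parallelogram.\<close>
  define \<delta> where "\<delta> = r / 3"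
  have d: "\<delta> > 0" using r by (simp add: \<delta>_def)
  have in_O: "x + s *\<^sub>R v + t *\<^sub>R w \<in> O'" if "0 \<le> s" "s \<le> \<delta>" "0 \<le> t" "t \<le> \<delta>" for s t
  proof -
    have "norm (s, t) \<le> \<bar>s\<bar> + \<bar>t\<bar>" using norm_Pair_le[of s t] by simp
    also have "\<dots> < r" using that r by (simp add: \<delta>_def)
    finally have "(s, t) \<in> q -` O'" using r by auto
    then show ?thesis by (simp add: q_def)
  qed
  then have in_S: "x + s *\<^sub>R v + t *\<^sub>R w \<in> S" "x + t *\<^sub>R w + s *\<^sub>R v \<in> S"
    if "0 \<le> s" "s \<le> \<delta>" "0 \<le> t" "t \<le> \<delta>" for s t
    using that by (auto simp: O'_def add.commute add.left_commute)
  have f: "f differentiable (at y)" "(\<lambda>y. frechet_derivative f (at y) u) differentiable (at y)"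
    if "y \<in> S" for y u
    using that sm smooth_on_frechet_derivative smooth_on_differentiable by blast+
  obtain s t where st: "0 < s" "s < \<delta>" "0 < t" "t < \<delta>"
    "f (x + \<delta> *\<^sub>R v + \<delta> *\<^sub>R w) - f (x + \<delta> *\<^sub>R v) - f (x + \<delta> *\<^sub>R w) + f x =
      \<delta> * (\<delta> * ?A (x + s *\<^sub>R v + t *\<^sub>R w))"
    by (rule second_difference_eq[OF d, where S=S and x=x and v=v and w=w]) (use f in_S in auto)
  obtain t' s' where st': "0 < t'" "t' < \<delta>" "0 < s'" "s' < \<delta>"
    "f (x + \<delta> *\<^sub>R w + \<delta> *\<^sub>R v) - f (x + \<delta> *\<^sub>R w) - f (x + \<delta> *\<^sub>R v) + f x =
      \<delta> * (\<delta> * ?B (x + t' *\<^sub>R w + s' *\<^sub>R v))"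
    by (rule second_difference_eq[OF d, where S=S and x=x and v=w and w=v]) (use f in_S in auto)
  have swap: "x + \<delta> *\<^sub>R w + \<delta> *\<^sub>R v = x + \<delta> *\<^sub>R v + \<delta> *\<^sub>R w" "x + t' *\<^sub>R w + s' *\<^sub>R v = x + s' *\<^sub>R v + t' *\<^sub>R w"
    by (simp_all add: algebra_simps)
  have "\<delta> * (\<delta> * ?A (x + s *\<^sub>R v + t *\<^sub>R w)) = \<delta> * (\<delta> * ?B (x + s' *\<^sub>R v + t' *\<^sub>R w))"
    using st(5) st'(5) unfolding swap by linarith
  with d have "?A (x + s *\<^sub>R v + t *\<^sub>R w) = ?B (x + s' *\<^sub>R v + t' *\<^sub>R w)"
    by simp
  moreover have "?A (x + s *\<^sub>R v + t *\<^sub>R w) \<in> ?U" "?B (x + s' *\<^sub>R v + t' *\<^sub>R w) \<in> ?V"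
    using in_O[of s t] in_O[of s' t'] st st' by (auto simp: O'_def)
  ultimately show False
    by (simp add: dist_real_def) argo
qed

lemma frechet_derivative_commute_vec:
  fixes f :: "'a::real_normed_vector \<Rightarrow> real ^ 'n::finite"
  assumes "open S" "x \<in> S" "smooth_on S f"
  shows "frechet_derivative (\<lambda>y. frechet_derivative f (at y) v) (at x) w =
    frechet_derivative (\<lambda>y. frechet_derivative f (at y) w) (at x) v"
proof -
  have *: "frechet_derivative (\<lambda>y. frechet_derivative f (at y) v) (at x) w $ i =
    frechet_derivative (\<lambda>y. frechet_derivative (\<lambda>y. f y $ i) (at y) v) (at x) w" for i v w
  proof -
    have "frechet_derivative (\<lambda>y. frechet_derivative f (at y) v) (at x) w $ i =
      frechet_derivative (\<lambda>y. frechet_derivative f (at y) v $ i) (at x) w"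
      using assms by (metis frechet_derivative_vec_nth smooth_on_frechet_derivative smooth_on_differentiable)
    also have "frechet_derivative (\<lambda>y. frechet_derivative f (at y) v $ i) (at x) =
      frechet_derivative (\<lambda>y. frechet_derivative (\<lambda>y. f y $ i) (at y) v) (at x)"
      using assms by (intro frechet_derivative_transform_within_open[where X=S] differentiable_vec_nth)
        (auto simp: frechet_derivative_vec_nth smooth_on_differentiable
          intro: smooth_on_differentiable[OF smooth_on_frechet_derivative])
    finally show ?thesis .
  qed
  show ?thesis
    by (simp add: vec_eq_iff * frechet_derivative_commute[OF assms(1,2) smooth_on_vec_nth[OF assms(1,3)]])
qed

lemma has_vector_derivative_vec_nthI:
  fixes f :: "real \<Rightarrow> real ^ 'n::finite"
  assumes "\<And>i. ((\<lambda>s. f s $ i) has_vector_derivative d $ i) (at t within T)"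
  shows "(f has_vector_derivative d) (at t within T)"
  using assms unfolding has_vector_derivative_def has_derivative_componentwise_within[where f=f]
  by (auto simp: Basis_vec_def inner_axis)

section \<open>Coordinate derivatives of contractions with y\<close>

lemma frechet_derivative_Pair_eq:
  fixes f :: "(real ^ 'n::finite) \<times> (real ^ 'n) \<Rightarrow> real"
  assumes "f differentiable (at p)"
  shows "frechet_derivative f (at p) (a, b) =
    (\<Sum>k\<in>UNIV. pdx k f p * a $ k) + (\<Sum>k\<in>UNIV. pdy k f p * b $ k)"
proof -
  let ?D = "frechet_derivative f (at p)"
  have lin: "linear ?D" using assms by (rule linear_frechet_derivative)
  have ab: "(a, b) = (\<Sum>k\<in>UNIV. a $ k *\<^sub>R (axis k 1, 0)) + (\<Sum>k\<in>UNIV. b $ k *\<^sub>R (0, axis k 1))"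
    by (simp add: prod_eq_iff fst_sum snd_sum basis_expansion flip: scalar_mult_eq_scaleR)
  show ?thesis
    unfolding ab by (simp add: linear_add[OF lin] linear_sum[OF lin] linear_cmul[OF lin] pdx_def pdy_def mult.commute del: scaleR_Pair)
qed

text \<open>The product rule for y^h f_h = \<Phi>; the correction term comes from differentiating
  the factor y^h. This is the device for differentiating Euler's relation and its
  consequences.\<close>

lemma frechet_derivative_contraction:
  fixes f :: "'n::finite \<Rightarrow> (real ^ 'n) \<times> (real ^ 'n) \<Rightarrow> real"
  assumes "open S" "p \<in> S" and f: "\<And>h. f h differentiable (at p)"
    and eq: "\<And>q. q \<in> S \<Longrightarrow> (\<Sum>h\<in>UNIV. snd q $ h * f h q) = \<Phi> q"
  shows "(\<Sum>h\<in>UNIV. snd p $ h * frechet_derivative (f h) (at p) v) =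
    frechet_derivative \<Phi> (at p) v - (\<Sum>h\<in>UNIV. snd v $ h * f h p)"
proof -
  have "((\<lambda>q. \<Sum>h\<in>UNIV. snd q $ h * f h q) has_derivative
      (\<lambda>v. \<Sum>h\<in>UNIV. snd p $ h * frechet_derivative (f h) (at p) v + snd v $ h * f h p)) (at p)"
    using f[unfolded frechet_derivative_works]
    by (intro has_derivative_sum has_derivative_mult bounded_linear.has_derivative[OF bounded_linear_vec_nth]
        has_derivative_snd has_derivative_ident) auto
  then have "(\<Phi> has_derivative
      (\<lambda>v. \<Sum>h\<in>UNIV. snd p $ h * frechet_derivative (f h) (at p) v + snd v $ h * f h p)) (at p)"
    using assms(1,2) eq by (rule has_derivative_transform_within_open)
  from frechet_derivative_at[OF this, symmetric] show ?thesis
    by (simp add: sum.distrib)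
qed

text \<open>A base direction leaves y fixed and gives no correction; the k-th fibre direction gives
  exactly the correction \<open>f k p\<close>.\<close>

lemma contraction_pd:
  fixes f :: "'n::finite \<Rightarrow> (real ^ 'n) \<times> (real ^ 'n) \<Rightarrow> real"
  assumes "open S" "p \<in> S" "\<And>h. f h differentiable (at p)"
    and "\<And>q. q \<in> S \<Longrightarrow> (\<Sum>h\<in>UNIV. snd q $ h * f h q) = \<Phi> q"
  shows contraction_pdx: "(\<Sum>h\<in>UNIV. snd p $ h * pdx k (f h) p) = pdx k \<Phi> p"
    and contraction_pdy: "(\<Sum>h\<in>UNIV. snd p $ h * pdy k (f h) p) = pdy k \<Phi> p - f k p"
proof -
  have "(\<Sum>h\<in>UNIV. axis k 1 $ h * f h p) = f k p"
    by (simp add: axis_def if_distrib[where f="\<lambda>x. x * _"] cong: if_cong)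
  then show "(\<Sum>h\<in>UNIV. snd p $ h * pdx k (f h) p) = pdx k \<Phi> p"
    "(\<Sum>h\<in>UNIV. snd p $ h * pdy k (f h) p) = pdy k \<Phi> p - f k p"
    by (simp_all add: pdx_def pdy_def frechet_derivative_contraction[OF assms])
qed

lemma smooth_on_pdy: "smooth_on S f \<Longrightarrow> smooth_on S (pdy k f)"
  unfolding pdy_def[abs_def] by (rule smooth_on_frechet_derivative)

section \<open>Homogeneity identities and the contracted curvature of a spray\<close>

text \<open>\<open>U\<close> stands for the image of a chart: the equation to be proved is an
  identity in each chart separately.\<close>

locale local_spray =
  fixes G :: "'n::finite field" and U :: "(real ^ 'n) set"
  assumes open_U: "open U"
    and smooth_G: "smooth_on (U \<times> (UNIV - {0})) G"
    and homogeneous: "\<And>x y r. x \<in> U \<Longrightarrow> y \<noteq> 0 \<Longrightarrow> r > 0 \<Longrightarrow> G (x, r *\<^sub>R y) = r\<^sup>2 *\<^sub>R G (x, y)"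
begin

abbreviation "slit \<equiv> U \<times> (UNIV - {0::real ^ 'n})"

lemma open_slit: "open slit"
  by (intro open_Times open_U open_Diff) auto

lemma smooth_nth: "smooth_on slit (\<lambda>p. G p $ i)"
  by (rule smooth_on_vec_nth[OF open_slit smooth_G])

lemma smooth_N: "smooth_on slit (Nconn G i j)"
  unfolding Nconn_def by (rule smooth_on_pdy[OF smooth_nth])

lemma smooth_L: "smooth_on slit (Lconn G i j k)"
  unfolding Lconn_def by (rule smooth_on_pdy[OF smooth_N])

lemmas differentiable_G = smooth_on_differentiable[OF smooth_G]
lemmas differentiable_nth = smooth_on_differentiable[OF smooth_nth]
lemmas differentiable_N = smooth_on_differentiable[OF smooth_N]
lemmas differentiable_L = smooth_on_differentiable[OF smooth_L]

text \<open>The derivative at r = 1 of G along the ray (x, r y) is computed twice, by the chain rule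
  and from the factor r^2. Homogeneity covers only r > 0, hence the open half-line.\<close>

lemma euler:
  assumes "p \<in> slit"
  shows "(\<Sum>j\<in>UNIV. snd p $ j * Nconn G i j p) = 2 * G p $ i"
proof -
  obtain x y where p: "p = (x, y)" "x \<in> U" "y \<noteq> 0" using assms by auto
  let ?g = "\<lambda>q. G q $ i"
  have "((\<lambda>r. ?g (x, r *\<^sub>R y)) has_vector_derivative
      frechet_derivative ?g (at (x, 1 *\<^sub>R y)) (0, 1 *\<^sub>R y)) (at 1)"
    using assms p(1)
    by (intro has_vector_derivative_along_curve[where f = ?g and \<gamma> = "\<lambda>r. (x, r *\<^sub>R y)"] differentiable_nth
        has_vector_derivative_Pair) (auto intro!: derivative_eq_intros simp: has_vector_derivative_def)
  then have *: "((\<lambda>r. ?g (x, r *\<^sub>R y)) has_vector_derivative frechet_derivative ?g (at p) (0, y)) (at 1)"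
    by (simp add: p)
  have "((\<lambda>r::real. r\<^sup>2 * ?g p) has_vector_derivative 2 * ?g p) (at 1)"
    by (auto intro!: derivative_eq_intros simp flip: has_real_derivative_iff_has_vector_derivative)
  then have "((\<lambda>r. ?g (x, r *\<^sub>R y)) has_vector_derivative 2 * ?g p) (at 1)"
    by (rule has_vector_derivative_transform_within_open[where S="{0<..}"]) (auto simp: homogeneous p)
  from vector_derivative_unique_at[OF this *]
  show ?thesis
    unfolding frechet_derivative_Pair_eq[OF differentiable_nth[OF assms]]
    by (simp add: Nconn_def p(1) mult.commute)
qed

lemma pd_twice_G:
  assumes "p \<in> slit"
  shows "pdx k (\<lambda>q. 2 * G q $ i) p = 2 * pdx k (\<lambda>q. G q $ i) p"
    "pdy k (\<lambda>q. 2 * G q $ i) p = 2 * Nconn G i k p"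
proof -
  have "((\<lambda>q. 2 * G q $ i) has_derivative (\<lambda>v. 2 * frechet_derivative (\<lambda>q. G q $ i) (at p) v)) (at p)"
    using differentiable_nth[OF assms] unfolding frechet_derivative_works by (rule has_derivative_mult_right)
  from frechet_derivative_at[OF this, symmetric]
  show "pdx k (\<lambda>q. 2 * G q $ i) p = 2 * pdx k (\<lambda>q. G q $ i) p"
    "pdy k (\<lambda>q. 2 * G q $ i) p = 2 * Nconn G i k p"
    by (simp_all add: pdx_def pdy_def Nconn_def)
qed

lemma Lconn_commute:
  assumes "p \<in> slit"
  shows "Lconn G i j k p = Lconn G i k j p"
  using frechet_derivative_commute[OF open_slit assms smooth_nth]
  by (simp add: Lconn_def Nconn_def pdy_def[abs_def])

text \<open>The k-th fibre derivative of Euler's relation leaves 2 N_k - N_k. The second form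
  follows by symmetry of L.\<close>

lemma Lconn_contraction:
  assumes "p \<in> slit"
  shows "(\<Sum>h\<in>UNIV. snd p $ h * Lconn G i h k p) = Nconn G i k p"
    "(\<Sum>h\<in>UNIV. snd p $ h * Lconn G i k h p) = Nconn G i k p"
proof -
  show "(\<Sum>h\<in>UNIV. snd p $ h * Lconn G i h k p) = Nconn G i k p"
    using contraction_pdy[where f="Nconn G i" and \<Phi>="\<lambda>q. 2 * G q $ i" and k=k,
        OF open_slit assms differentiable_N[OF assms] euler] pd_twice_G(2)[OF assms]
    by (simp add: Lconn_def)
  then show "(\<Sum>h\<in>UNIV. snd p $ h * Lconn G i k h p) = Nconn G i k p"
    by (subst Lconn_commute[OF assms])
qed

text \<open>Euler's relation differentiated in x^k.\<close>

lemma pdx_Nconn_contraction: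
  assumes "p \<in> slit"
  shows "(\<Sum>j\<in>UNIV. snd p $ j * pdx k (Nconn G i j) p) = 2 * pdx k (\<lambda>q. G q $ i) p"
  using contraction_pdx[where f="Nconn G i" and \<Phi>="\<lambda>q. 2 * G q $ i" and k=k,
        OF open_slit assms differentiable_N[OF assms] euler] pd_twice_G(1)[OF assms]
  by simp

text \<open>
  The vertical part of \<open>\<delta>\<^sub>l\<close> drops out because \<open>y\<^sup>h \<partial>L\<^sup>i\<^sub>h\<^sub>k/\<partial>y\<^sup>m = L\<^sup>i\<^sub>k\<^sub>m - L\<^sup>i\<^sub>m\<^sub>k = 0\<close>.
\<close>

lemma delta_Lconn_contraction:
  assumes "p \<in> slit"
  shows "(\<Sum>h\<in>UNIV. snd p $ h * delta G l (Lconn G i h k) p) = pdx l (Nconn G i k) p"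
proof -
  have x: "(\<Sum>h\<in>UNIV. snd p $ h * pdx l (Lconn G i h k) p) = pdx l (Nconn G i k) p"
    by (rule contraction_pdx[OF open_slit assms differentiable_L[OF assms] Lconn_contraction(1)])
  have y: "(\<Sum>h\<in>UNIV. snd p $ h * pdy m (Lconn G i h k) p) = 0" for m
  proof -
    have "(\<Sum>h\<in>UNIV. snd p $ h * pdy m (Lconn G i h k) p) = pdy m (Nconn G i k) p - Lconn G i m k p"
      by (rule contraction_pdy[OF open_slit assms differentiable_L[OF assms] Lconn_contraction(1)])
    then show ?thesis
      using Lconn_commute[OF assms, of i k m] by (simp add: Lconn_def)
  qed
  have "(\<Sum>h\<in>UNIV. snd p $ h * (\<Sum>m\<in>UNIV. Nconn G m l p * pdy m (Lconn G i h k) p)) =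
    (\<Sum>m\<in>UNIV. Nconn G m l p * (\<Sum>h\<in>UNIV. snd p $ h * pdy m (Lconn G i h k) p))"
    unfolding sum_distrib_left by (subst sum.swap) (simp add: mult.left_commute)
  then show ?thesis
    by (simp add: delta_def right_diff_distrib sum_subtractf x y)
qed

text \<open>Contraction in h turns \<delta>L into a base derivative of N, and one L of each
  quadratic term into N. Contraction in j then turns the remaining L of the first quadratic term
  into N, and the N carrying j in the second into 2G. The result has the shape in which the
  expansion of \<open>Dt G x (Dt G x w)\<close> produces its terms.\<close>

lemma Rcurv_contraction:
  assumes "p \<in> slit"
  shows "(\<Sum>h\<in>UNIV. \<Sum>j\<in>UNIV. snd p $ h * snd p $ j * Rcurv G h i k j p) =
    (\<Sum>j\<in>UNIV. snd p $ j * pdx j (Nconn G i k) p) - 2 * pdx k (\<lambda>q. G q $ i) p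
    + (\<Sum>m\<in>UNIV. Nconn G i m p * Nconn G m k p) - 2 * (\<Sum>m\<in>UNIV. Lconn G i m k p * G p $ m)"
proof -
  have quad: "(\<Sum>h\<in>UNIV. snd p $ h * (\<Sum>m\<in>UNIV. Lconn G m h a p * Lconn G i m b p)) =
    (\<Sum>m\<in>UNIV. Nconn G m a p * Lconn G i m b p)" for a b
  proof -
    have "(\<Sum>h\<in>UNIV. snd p $ h * (\<Sum>m\<in>UNIV. Lconn G m h a p * Lconn G i m b p)) =
      (\<Sum>m\<in>UNIV. (\<Sum>h\<in>UNIV. snd p $ h * Lconn G m h a p) * Lconn G i m b p)"
      unfolding sum_distrib_left sum_distrib_right by (subst sum.swap) (simp add: mult.assoc)
    then show ?thesis by (simp add: Lconn_contraction(1)[OF assms])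
  qed
  have R: "(\<Sum>h\<in>UNIV. snd p $ h * Rcurv G h i k j p) =
    pdx j (Nconn G i k) p - pdx k (Nconn G i j) p
    + (\<Sum>m\<in>UNIV. Nconn G m k p * Lconn G i m j p) - (\<Sum>m\<in>UNIV. Nconn G m j p * Lconn G i m k p)" for j
    unfolding Rcurv_def
    by (simp only: ring_distribs sum.distrib sum_subtractf quad delta_Lconn_contraction[OF assms])
  \<comment> \<open>Here j is the last lower index of L, so the second form of
    \<open>Lconn_contraction\<close> applies.\<close>
  have NL: "(\<Sum>j\<in>UNIV. snd p $ j * (\<Sum>m\<in>UNIV. Nconn G m k p * Lconn G i m j p)) =
    (\<Sum>m\<in>UNIV. Nconn G i m p * Nconn G m k p)"
  proof -
    have "(\<Sum>j\<in>UNIV. snd p $ j * (\<Sum>m\<in>UNIV. Nconn G m k p * Lconn G i m j p)) =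
      (\<Sum>m\<in>UNIV. (\<Sum>j\<in>UNIV. snd p $ j * Lconn G i m j p) * Nconn G m k p)"
      unfolding sum_distrib_left sum_distrib_right by (subst sum.swap) (simp add: mult_ac)
    then show ?thesis by (simp add: Lconn_contraction(2)[OF assms])
  qed
  have GL: "(\<Sum>j\<in>UNIV. snd p $ j * (\<Sum>m\<in>UNIV. Nconn G m j p * Lconn G i m k p)) =
    2 * (\<Sum>m\<in>UNIV. Lconn G i m k p * G p $ m)"
  proof -
    have "(\<Sum>j\<in>UNIV. snd p $ j * (\<Sum>m\<in>UNIV. Nconn G m j p * Lconn G i m k p)) =
      (\<Sum>m\<in>UNIV. (\<Sum>j\<in>UNIV. snd p $ j * Nconn G m j p) * Lconn G i m k p)"
      unfolding sum_distrib_left sum_distrib_right by (subst sum.swap) (simp add: mult_ac)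
    also have "\<dots> = (\<Sum>m\<in>UNIV. 2 * (Lconn G i m k p * G p $ m))"
      by (simp add: euler[OF assms] mult_ac)
    finally show ?thesis by (simp add: sum_distrib_left)
  qed
  have "(\<Sum>h\<in>UNIV. \<Sum>j\<in>UNIV. snd p $ h * snd p $ j * Rcurv G h i k j p) =
    (\<Sum>j\<in>UNIV. snd p $ j * (\<Sum>h\<in>UNIV. snd p $ h * Rcurv G h i k j p))"
    unfolding sum_distrib_left by (subst sum.swap) (simp add: mult_ac)
  then show ?thesis
    by (simp only: R ring_distribs sum.distrib sum_subtractf NL GL pdx_Nconn_contraction[OF assms])
qed

end

section \<open>One-sided derivatives and slices of two-parameter maps\<close>

text \<open>Agreement is asked only at points of \<open>T\<close> near \<open>t\<close>, which is
  all that a smooth extension of a map on [0,1] provides.\<close>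

lemma has_vector_derivative_transform_within_open_Int:
  fixes f :: "real \<Rightarrow> 'b::real_normed_vector"
  assumes "(h has_vector_derivative d) (at t within T)" "t \<in> T"
    and "open V" "t \<in> V" "\<And>s. s \<in> T \<Longrightarrow> s \<in> V \<Longrightarrow> h s = f s"
  shows "(f has_vector_derivative d) (at t within T)"
proof -
  obtain \<delta> where "\<delta> > 0" "ball t \<delta> \<subseteq> V" using assms(3,4) by (meson openE)
  then show ?thesis
    using assms by (intro has_vector_derivative_transform_within[OF assms(1), of \<delta>])
      (auto simp: subset_eq dist_commute)
qed

lemma open_slices:
  fixes W :: "(real \<times> real) set"
  assumes "open W"
  shows "open {s. (s, u) \<in> W}" "open {u. (s, u) \<in> W}"
proof -
  have "open ((\<lambda>s. (s, u)) -` W)" "open ((\<lambda>u. (s, u)) -` W)"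
    using assms by (auto intro!: open_vimage continuous_intros)
  then show "open {s. (s, u) \<in> W}" "open {u. (s, u) \<in> W}" by (simp_all add: vimage_def)
qed

lemma has_vector_derivative_slices:
  fixes h :: "real \<times> real \<Rightarrow> 'b::real_normed_vector"
  assumes "h differentiable (at (t, u))"
  shows "((\<lambda>s. h (s, u)) has_vector_derivative frechet_derivative h (at (t, u)) (1, 0)) (at t within T)"
    and "((\<lambda>v. h (t, v)) has_vector_derivative frechet_derivative h (at (t, u)) (0, 1)) (at u within T)"
proof -
  have "((\<lambda>s. (s, u)) has_vector_derivative (1, 0)) (at t within T)"
    "((\<lambda>v. (t, v)) has_vector_derivative (0, 1)) (at u within T)"
    by (auto intro!: derivative_eq_intros simp: has_vector_derivative_def)
  then show "((\<lambda>s. h (s, u)) has_vector_derivative frechet_derivative h (at (t, u)) (1, 0)) (at t within T)"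
    "((\<lambda>v. h (t, v)) has_vector_derivative frechet_derivative h (at (t, u)) (0, 1)) (at u within T)"
    using has_vector_derivative_along_curve[where f=h and \<gamma>="\<lambda>s. (s, u)", OF assms]
      has_vector_derivative_along_curve[where f=h and \<gamma>="\<lambda>v. (t, v)", OF assms] by blast+
qed

text \<open>On the nondegenerate interval [0,1] the derivative is unique even at the
  endpoints.\<close>

lemma ddt_eqI:
  assumes "(f has_vector_derivative d) (at t within {0..1})" "t \<in> {0..1}"
  shows "ddt f t = d"
  unfolding ddt_def
  using assms vector_derivative_within_cbox[of 0 1 t f d] by simp

text \<open>Trades \<open>ddt\<close> for a partial derivative of an extension on an open set, where
  derivatives can be iterated and commuted.\<close>

lemma ddt_slice:
  fixes h :: "real \<times> real \<Rightarrow> 'b::real_normed_vector"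
  assumes "open W" "h differentiable (at (t, u))" "t \<in> {0..1}" "(t, u) \<in> W"
    and "\<And>s. s \<in> {0..1} \<Longrightarrow> (s, u) \<in> W \<Longrightarrow> f s = h (s, u)"
  shows "ddt f t = frechet_derivative h (at (t, u)) (1, 0)"
  using assms
  by (intro ddt_eqI has_vector_derivative_transform_within_open_Int[OF has_vector_derivative_slices(1)[OF assms(2)] _
        open_slices(1)[OF assms(1), of u]]) auto

section \<open>The Jacobi equation in one chart\<close>

text \<open>
  The smooth extension \<open>g\<close> makes sense of two-sided derivatives at the endpoints of \<open>[0,1]\<close>;
  the curve \<open>x\<close> is only tied to the variation for parameters in \<open>[0,1]\<close>.
\<close>

lemma (in local_spray) jacobi_equation:
  fixes \<xi> :: "real \<Rightarrow> real \<Rightarrow> real ^ 'n" and x w :: "real \<Rightarrow> real ^ 'n" and F :: "'n field"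
  assumes W: "open W" "(t, 0) \<in> W" "t \<in> {0..1}" and g: "smooth_on W g"
    and \<xi>: "\<And>s u. s \<in> {0..1} \<Longrightarrow> (s, u) \<in> W \<Longrightarrow> \<xi> s u = g (s, u)"
    and in_U: "\<And>s u. s \<in> {0..1} \<Longrightarrow> (s, u) \<in> W \<Longrightarrow> \<xi> s u \<in> U"
    and regular: "\<And>s u. s \<in> {0..1} \<Longrightarrow> (s, u) \<in> W \<Longrightarrow> ddt (\<lambda>s. \<xi> s u) s \<noteq> 0"
    and sol: "\<And>s u. s \<in> {0..1} \<Longrightarrow> (s, u) \<in> W \<Longrightarrow>
      Dt G (\<lambda>s. \<xi> s u) (ddt (\<lambda>s. \<xi> s u)) s = F (\<xi> s u, ddt (\<lambda>s. \<xi> s u) s)"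
    and x: "\<And>s. s \<in> {0..1} \<Longrightarrow> x s = \<xi> s 0"
    and w: "\<And>s. w s = vector_derivative (\<xi> s) (at 0)"
  shows "Dt G x (Dt G x w) t $ i = DF_Du G F \<xi> t 0 $ i
    + (\<Sum>h\<in>UNIV. \<Sum>j\<in>UNIV. \<Sum>k\<in>UNIV. ddt x t $ h * ddt x t $ j * Rcurv G h i k j (x t, ddt x t) * w t $ k)"
proof -
  let ?d = "\<lambda>v f p. frechet_derivative f (at p) v"
  \<comment> \<open>These extend y and w to functions of both parameters on the open set
    \<open>W\<close>.\<close>
  define gt gu where "gt = ?d (1, 0) g" and "gu = ?d (0, 1) g"
  have smooth: "smooth_on W gt" "smooth_on W gu" "smooth_on W (?d (1, 0) gt)" "smooth_on W (?d (1, 0) gu)"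
    unfolding gt_def gu_def using g by (intro smooth_on_frechet_derivative; assumption)+
  have diff: "g differentiable (at p)" "gt differentiable (at p)" "gu differentiable (at p)"
    "?d (1, 0) gt differentiable (at p)" "?d (1, 0) gu differentiable (at p)" if "p \<in> W" for p
    using that smooth g smooth_on_differentiable by blast+
  have gtu: "?d (0, 1) gt p = ?d (1, 0) gu p" if "p \<in> W" for p
    unfolding gt_def gu_def by (rule frechet_derivative_commute_vec[OF W(1) that g])
  \<comment> \<open>The u-derivative passes the outer t-derivative by symmetry for
    \<open>gt\<close>, and the inner one by \<open>gtu\<close>, which holds on all of
    \<open>W\<close> and may therefore be differentiated.\<close>
  have gttu: "?d (0, 1) (?d (1, 0) gt) (t, 0) = ?d (1, 0) (?d (1, 0) gu) (t, 0)"
  proof -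
    have "?d (0, 1) (?d (1, 0) gt) (t, 0) = ?d (1, 0) (?d (0, 1) gt) (t, 0)"
      by (rule frechet_derivative_commute_vec[OF W(1,2) smooth(1)])
    also have "frechet_derivative (?d (0, 1) gt) (at (t, 0)) = frechet_derivative (?d (1, 0) gu) (at (t, 0))"
      using smooth_on_differentiable[OF smooth_on_frechet_derivative[OF smooth(1)] W(2)] W(1,2) gtu
      by (rule frechet_derivative_transform_within_open)
    finally show ?thesis .
  qed

  have ddt_\<xi>: "ddt (\<lambda>s. \<xi> s u) s = gt (s, u)" if "s \<in> {0..1}" "(s, u) \<in> W" for s u
    unfolding gt_def using diff(1) that \<xi> by (intro ddt_slice[OF W(1)])
  have ddt2_\<xi>: "ddt (ddt (\<lambda>s. \<xi> s u)) s = ?d (1, 0) gt (s, u)" if "s \<in> {0..1}" "(s, u) \<in> W" for s u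
    using diff(2) that ddt_\<xi> by (intro ddt_slice[OF W(1)])
  have ddt_x: "ddt x s = gt (s, 0)" if "s \<in> {0..1}" "(s, 0) \<in> W" for s
    unfolding gt_def using diff(1) that \<xi> x by (intro ddt_slice[OF W(1)]) auto
  \<comment> \<open>Stated for all s near t, because w is differentiated in t afterwards.\<close>
  have w_eq: "w s = gu (s, 0)" if "s \<in> {0..1}" "(s, 0) \<in> W" for s
  proof -
    have "(\<xi> s has_vector_derivative gu (s, 0)) (at 0)"
      unfolding gu_def
      using that \<xi>[OF that(1)]
      by (intro has_vector_derivative_transform_within_open_Int[OF has_vector_derivative_slices(2)[OF diff(1)[OF that(2)]] _
            open_slices(2)[OF W(1), of s]]) auto
    then show ?thesis by (simp add: w vector_derivative_at)
  qed
  have ddt_w: "ddt w s = ?d (1, 0) gu (s, 0)" if "s \<in> {0..1}" "(s, 0) \<in> W" for s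
    using diff(3) that w_eq by (intro ddt_slice[OF W(1)])

  \<comment> \<open>The lift of the variation to the tangent bundle.\<close>
  define P where "P q = (g q, gt q)" for q
  have slit: "P (s, u) \<in> slit" if "s \<in> {0..1}" "(s, u) \<in> W" for s u
    using that in_U regular by (auto simp: P_def \<xi> ddt_\<xi>)
  define p y y' w' w'' where "p = P (t, 0)" and "y = gt (t, 0)" and "y' = ?d (1, 0) gt (t, 0)"
    and "w' = ?d (1, 0) gu (t, 0)" and "w'' = ?d (1, 0) (?d (1, 0) gu) (t, 0)"
  have p: "p \<in> slit" using slit W by (simp add: p_def)
  have p_eq: "p = (x t, y)" "snd p = y" "ddt x t = y" "ddt w t = w'" "w t = gu (t, 0)"
    using W by (simp_all add: p_def P_def y_def w'_def ddt_x ddt_w w_eq x \<xi>)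
  \<comment> \<open>Euler's relation replaces N y by 2G. The identity holds at nearby parameters
    too, so it can be differentiated in u.\<close>
  have newton: "F (P (s, u)) = ?d (1, 0) gt (s, u) + 2 *\<^sub>R G (P (s, u))"
    if "s \<in> {0..1}" "(s, u) \<in> W" for s u
    using sol[OF that] euler[OF slit[OF that]] that
    by (simp add: Dt_def ddt_\<xi> ddt2_\<xi> \<xi> P_def vec_eq_iff mult.commute)

  have dt: "((\<lambda>s. g (s, 0)) has_vector_derivative y) (at t within {0..1})"
    "((\<lambda>s. gt (s, 0)) has_vector_derivative y') (at t within {0..1})"
    "((\<lambda>s. gu (s, 0)) has_vector_derivative w') (at t within {0..1})"
    "((\<lambda>s. ?d (1, 0) gu (s, 0)) has_vector_derivative w'') (at t within {0..1})"
    using diff(1,2,3,5)[OF W(2), THEN has_vector_derivative_slices(1)]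
    by (simp_all add: y_def y'_def w'_def w''_def gt_def)
  \<comment> \<open>By \<open>gtu\<close> and \<open>gttu\<close>, the u-derivatives of y and y' are
    w' and w''.\<close>
  have du: "((\<lambda>u. g (t, u)) has_vector_derivative w t) (at 0)"
    "((\<lambda>u. gt (t, u)) has_vector_derivative w') (at 0)"
    "((\<lambda>u. ?d (1, 0) gt (t, u)) has_vector_derivative w'') (at 0)"
    using diff(1,2,4)[OF W(2), THEN has_vector_derivative_slices(2)] gtu[OF W(2)] gttu
    by (simp_all add: p_eq(5) w'_def w''_def gu_def)
  have along_t: "((\<lambda>s. f (P (s, 0))) has_vector_derivative ?d (y, y') f p) (at t within {0..1})"
    if "f differentiable (at p)" for f :: "(real ^ 'n) \<times> (real ^ 'n) \<Rightarrow> real"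
    unfolding p_def
    using that dt(1,2) by (intro has_vector_derivative_along_curve[where \<gamma>="\<lambda>s. P (s, 0)"])
      (auto simp: P_def p_def intro!: has_vector_derivative_Pair)
  have along_u: "((\<lambda>u. G (P (t, u))) has_vector_derivative ?d (w t, w') G p) (at 0)"
    unfolding p_def
    using differentiable_G[OF p] du(1,2) by (intro has_vector_derivative_along_curve[where \<gamma>="\<lambda>u. P (t, u)"])
      (auto simp: P_def p_def intro!: has_vector_derivative_Pair)

  \<comment> \<open>The u-derivative of F along the variation is read off from the right-hand side
    of \<open>newton\<close>; this is where w'' enters.\<close>
  have "((\<lambda>u. ?d (1, 0) gt (t, u) + 2 *\<^sub>R G (P (t, u))) has_vector_derivative w'' + 2 *\<^sub>R ?d (w t, w') G p) (at 0)"
    using du(3) along_u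
    by (intro has_vector_derivative_add bounded_linear.has_vector_derivative[OF bounded_linear_scaleR_right])
  then have "((\<lambda>u. F (\<xi> t u, ddt (\<lambda>s. \<xi> s u) t)) has_vector_derivative w'' + 2 *\<^sub>R ?d (w t, w') G p) (at 0)"
    using W newton
    by (elim has_vector_derivative_transform_within_open_Int[OF _ _ open_slices(2)[OF W(1), of t]])
       (auto simp: \<xi> ddt_\<xi> P_def)
  note dF = vector_derivative_at[OF this]
  have dG: "?d (w t, w') G p $ i =
      (\<Sum>k\<in>UNIV. pdx k (\<lambda>q. G q $ i) p * w t $ k) + (\<Sum>k\<in>UNIV. Nconn G i k p * w' $ k)" for i
    by (simp add: frechet_derivative_vec_nth[OF differentiable_G[OF p], symmetric]
        frechet_derivative_Pair_eq[OF differentiable_nth[OF p]] Nconn_def)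
  \<comment> \<open>The undifferentiated F in the connection term is also replaced, by y' +
    2G.\<close>
  have DF: "DF_Du G F \<xi> t 0 $ i = w'' $ i
      + 2 * ((\<Sum>k\<in>UNIV. pdx k (\<lambda>q. G q $ i) p * w t $ k) + (\<Sum>k\<in>UNIV. Nconn G i k p * w' $ k))
      + (\<Sum>j\<in>UNIV. \<Sum>k\<in>UNIV. Lconn G i j k p * (y' $ j + 2 * G p $ j) * w t $ k)"
  proof -
    have "(\<xi> t 0, ddt (\<lambda>s. \<xi> s 0) t) = p" using W by (simp add: ddt_\<xi> p_eq(1) y_def x)
    moreover have "F p = y' + 2 *\<^sub>R G p" using newton W by (simp add: p_def y'_def)
    ultimately show ?thesis
      unfolding DF_Du_def Let_def by (simp add: dF dG flip: w)
  qed

  \<comment> \<open>The t-derivative of w' + N w by the product rule: N is differentiated along a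
    curve with velocity (y, y'), and its fibre derivatives are L.\<close>
  define v' where "v' = (\<chi> i. w'' $ i + (\<Sum>j\<in>UNIV. Nconn G i j p * w' $ j
      + ((\<Sum>k\<in>UNIV. pdx k (Nconn G i j) p * y $ k) + (\<Sum>k\<in>UNIV. Lconn G i j k p * y' $ k)) * w t $ j))"
  have ddt_Dw: "ddt (Dt G x w) t = v'"
  proof (rule ddt_eqI[OF has_vector_derivative_vec_nthI W(3)])
    fix i
    have "((\<lambda>s. ?d (1, 0) gu (s, 0) $ i + (\<Sum>j\<in>UNIV. Nconn G i j (P (s, 0)) * gu (s, 0) $ j)) has_vector_derivative
      w'' $ i + (\<Sum>j\<in>UNIV. Nconn G i j p * w' $ j + ?d (y, y') (Nconn G i j) p * w t $ j)) (at t within {0..1})"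
      unfolding p_def p_eq(5)
      using dt(3,4) along_t[OF differentiable_N[OF p], unfolded p_def]
      by (intro has_vector_derivative_add has_vector_derivative_sum has_vector_derivative_mult
          bounded_linear.has_vector_derivative[OF bounded_linear_vec_nth])
    then have "((\<lambda>s. Dt G x w s $ i) has_vector_derivative
      w'' $ i + (\<Sum>j\<in>UNIV. Nconn G i j p * w' $ j + ?d (y, y') (Nconn G i j) p * w t $ j)) (at t within {0..1})"
      using W by (elim has_vector_derivative_transform_within_open_Int[OF _ _ open_slices(1)[OF W(1), of 0]])
         (auto simp: Dt_def ddt_w ddt_x w_eq x \<xi> P_def)
    then show "((\<lambda>s. Dt G x w s $ i) has_vector_derivative v' $ i) (at t within {0..1})"
      by (simp add: v'_def frechet_derivative_Pair_eq[OF differentiable_N[OF p]] Lconn_def)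
  qed
  have "Dt G x (Dt G x w) t $ i = v' $ i + (\<Sum>j\<in>UNIV. Nconn G i j p * (w' $ j + (\<Sum>k\<in>UNIV. Nconn G j k p * w t $ k)))"
    \<comment> \<open>Only the outer \<open>Dt\<close> is unfolded first, so that
      \<open>ddt_Dw\<close> can rewrite the derivative of the inner one.\<close>
    by (subst Dt_def) (simp add: ddt_Dw p_eq(3) flip: p_eq(1), simp add: Dt_def p_eq(3,4) flip: p_eq(1))
  \<comment> \<open>This and the next two facts regroup the double and triple sums as coefficients
    of w^k.\<close>
  moreover have "(\<Sum>h\<in>UNIV. \<Sum>j\<in>UNIV. \<Sum>k\<in>UNIV. y $ h * y $ j * Rcurv G h i k j p * w t $ k) =
    (\<Sum>k\<in>UNIV. ((\<Sum>j\<in>UNIV. y $ j * pdx j (Nconn G i k) p) - 2 * pdx k (\<lambda>q. G q $ i) p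
    + (\<Sum>m\<in>UNIV. Nconn G i m p * Nconn G m k p) - 2 * (\<Sum>m\<in>UNIV. Lconn G i m k p * G p $ m)) * w t $ k)"
  proof -
    have "(\<Sum>h\<in>UNIV. \<Sum>j\<in>UNIV. \<Sum>k\<in>UNIV. y $ h * y $ j * Rcurv G h i k j p * w t $ k) =
      (\<Sum>h\<in>UNIV. \<Sum>k\<in>UNIV. \<Sum>j\<in>UNIV. y $ h * y $ j * Rcurv G h i k j p * w t $ k)"
      by (intro sum.cong refl sum.swap)
    also have "\<dots> = (\<Sum>k\<in>UNIV. (\<Sum>h\<in>UNIV. \<Sum>j\<in>UNIV. y $ h * y $ j * Rcurv G h i k j p) * w t $ k)"
      unfolding sum_distrib_right by (rule sum.swap)
    finally show ?thesis
      using Rcurv_contraction[OF p, of i] by (simp add: p_eq(2))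
  qed
  \<comment> \<open>Symmetry of L matches the y' term of \<open>DF\<close> with the one that dN/dt
    contributes to \<open>v'\<close>.\<close>
  moreover have "(\<Sum>j\<in>UNIV. \<Sum>k\<in>UNIV. Lconn G i j k p * (y' $ j + 2 * G p $ j) * w t $ k) =
    (\<Sum>k\<in>UNIV. ((\<Sum>j\<in>UNIV. Lconn G i k j p * y' $ j) + 2 * (\<Sum>j\<in>UNIV. Lconn G i j k p * G p $ j)) * w t $ k)"
    unfolding sum_distrib_left sum_distrib_right distrib_right
    by (subst sum.swap) (simp add: ring_distribs sum.distrib sum_distrib_right mult_ac Lconn_commute[OF p, of i])
  moreover have "(\<Sum>j\<in>UNIV. Nconn G i j p * (\<Sum>k\<in>UNIV. Nconn G j k p * w t $ k)) =
    (\<Sum>k\<in>UNIV. (\<Sum>m\<in>UNIV. Nconn G i m p * Nconn G m k p) * w t $ k)"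
    unfolding sum_distrib_left sum_distrib_right by (subst sum.swap) (simp add: mult.assoc)
  \<comment> \<open>The two N w' terms, from \<open>v'\<close> and from the outer \<open>Dt\<close>,
    match the 2 N w' of \<open>DF\<close>; the derivatives of G and the products L G in
    \<open>DF\<close> cancel against the curvature.\<close>
  ultimately show ?thesis
    unfolding p_eq(3) p_eq(1)[symmetric] DF v'_def
    by (simp add: ring_distribs sum.distrib sum_subtractf sum_distrib_left mult_ac)
qed

section \<open>From the manifold to a chart\<close>

theorem theorem3:
  fixes X :: "'a topology" and A :: "('a, 'n::finite) chart set"
    and G F :: "('a, 'n) chart \<Rightarrow> 'n field"
    and c :: "real \<Rightarrow> 'a" and \<sigma> :: "real \<times> real \<Rightarrow> 'a" and \<epsilon> :: real
  assumes manifold: "smooth_manifold X A"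
    and spray: "spray A G"
    and field: "d_vector_field A F"
    and solution: "solution_curve A G F c"
    and eps: "\<epsilon> > 0"
    and variation: "smooth_map_into A ({0..1} \<times> {-\<epsilon><..<\<epsilon>}) \<sigma>"
    and base: "\<And>t. t \<in> {0..1} \<Longrightarrow> \<sigma> (t, 0) = c t"
    and solutions: "\<And>u. u \<in> {-\<epsilon><..<\<epsilon>} \<Longrightarrow> solution_curve A G F (\<lambda>t. \<sigma> (t, u))"
  shows "\<forall>C\<in>A. \<forall>t\<in>{0..1}. c t \<in> fst C \<longrightarrow>
    (let x = snd C \<circ> c; y = ddt x;
         \<xi> = (\<lambda>t u. snd C (\<sigma> (t, u)));
         w = (\<lambda>t. vector_derivative (\<xi> t) (at 0))
     in \<forall>i. Dt (G C) x (Dt (G C) x w) t $ i =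
          DF_Du (G C) (F C) \<xi> t 0 $ i
          + (\<Sum>h\<in>UNIV. \<Sum>j\<in>UNIV. \<Sum>k\<in>UNIV.
               y t $ h * y t $ j * Rcurv (G C) h i k j (x t, y t) * w t $ k))"
proof (intro ballI impI)
  fix C t
  assume C: "C \<in> A" and t: "t \<in> {0..1::real}" and ct: "c t \<in> fst C"
  let ?S = "{0..1::real} \<times> {-\<epsilon><..<\<epsilon>}"
  interpret local_spray "G C" "snd C ` fst C"
  proof
    show "open (snd C ` fst C)" using manifold C by (simp add: smooth_manifold_def)
    have "smooth_on (slit_domain C) (G C) \<and>
        (\<forall>(x, y)\<in>slit_domain C. \<forall>r>0. G C (x, r *\<^sub>R y) = r\<^sup>2 *\<^sub>R G C (x, y))"
      using spray C unfolding spray_def by blast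
    then show "smooth_on (snd C ` fst C \<times> (UNIV - {0})) (G C)"
      and "\<And>x y r. x \<in> snd C ` fst C \<Longrightarrow> y \<noteq> 0 \<Longrightarrow> r > 0 \<Longrightarrow> G C (x, r *\<^sub>R y) = r\<^sup>2 *\<^sub>R G C (x, y)"
      by (auto simp: slit_domain_def)
  qed
  have "(t, 0) \<in> ?S" "\<sigma> (t, 0) \<in> fst C" using t eps ct base by auto
  then obtain W0 g where W0: "open W0" "(t, 0) \<in> W0" "smooth_on W0 g"
    and g: "\<And>q. q \<in> ?S \<inter> W0 \<Longrightarrow> \<sigma> q \<in> fst C \<and> snd C (\<sigma> q) = g q"
    using variation C unfolding smooth_map_into_def by meson
  \<comment> \<open>Only u is restricted, so that every curve meeting \<open>W\<close> is a
    solution. In t the extension may leave [0,1], which keeps \<open>W\<close> open around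
    endpoints.\<close>
  define W where "W = W0 \<inter> (UNIV \<times> {-\<epsilon><..<\<epsilon>})"
  have W: "open W" "(t, 0) \<in> W" using W0 eps by (auto simp: W_def intro!: open_Int open_Times)
  have smooth_g: "smooth_on W g"
    using W0(3) smooth_on_subset[of W0 g W] by (simp add: W_def)
  have in_W: "\<sigma> (s, u) \<in> fst C" "snd C (\<sigma> (s, u)) = g (s, u)"
    and sol: "solution_curve A G F (\<lambda>t. \<sigma> (t, u))" if "s \<in> {0..1}" "(s, u) \<in> W" for s u
    using that g[of "(s, u)"] solutions by (auto simp: W_def)
  show "let x = snd C \<circ> c; y = ddt x;
         \<xi> = (\<lambda>t u. snd C (\<sigma> (t, u)));
         w = (\<lambda>t. vector_derivative (\<xi> t) (at 0))
     in \<forall>i. Dt (G C) x (Dt (G C) x w) t $ i =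
          DF_Du (G C) (F C) \<xi> t 0 $ i
          + (\<Sum>h\<in>UNIV. \<Sum>j\<in>UNIV. \<Sum>k\<in>UNIV.
               y t $ h * y t $ j * Rcurv (G C) h i k j (x t, y t) * w t $ k)"
    unfolding Let_def
  proof (intro allI jacobi_equation[OF W t smooth_g])
    fix s u assume su: "s \<in> {0..1::real}" "(s, u) \<in> W"
    show "snd C (\<sigma> (s, u)) = g (s, u)" by (rule in_W(2)[OF su])
    show "snd C (\<sigma> (s, u)) \<in> snd C ` fst C" by (rule imageI[OF in_W(1)[OF su]])
    show "ddt (\<lambda>s. snd C (\<sigma> (s, u))) s \<noteq> 0"
      "Dt (G C) (\<lambda>s. snd C (\<sigma> (s, u))) (ddt (\<lambda>s. snd C (\<sigma> (s, u)))) s =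
        F C (snd C (\<sigma> (s, u)), ddt (\<lambda>s. snd C (\<sigma> (s, u))) s)"
      using sol[OF su] C su(1) in_W(1)[OF su] by (auto simp: solution_curve_def Let_def o_def)
  qed (auto simp: base)
qed

end
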